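(* For all integers $n\geq 2$, we have $$|S_n^{(2)}(123:231)|=n+2\binom{n}{3}.$$
   Context: $S_n$ denotes the set of permutations $p=p(1)p(2)\cdots p(n)$ of $\{1,2,\ldots,n\}$ in one-line notation. For $p\in S_n$ and $q\in S_m$, $p$ contains $q$ as a pattern if there exist $1\leq i_1<\cdots<i_m\leq n$ such that for all $1\leq a<b\leq m$, $p(i_a)<p(i_b)$ if and only if $q(a)<q(b)$; otherwise $p$ avoids $q$. For $p\in S_n$ with $n\geq 2$, $p^{(2)}=p(2)p(3)\cdots p(n)p(1)$. For $q_1,q_2\in S_3$, $S_n^{(2)}(q_1:q_2)$ is the set of $p\in S_n$ such that $p$ avoids $q_1$ and $p^{(2)}$ avoids $q_2$. *)

theory Defs
  imports "HOL-Combinatorics.Multiset_Permutations"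
begin

text \<open>
  A permutation \<open>p(1) p(2) \<dots> p(n)\<close> is represented by its one-line notation, that is, by the list
  of its values. List positions start at 0, so \<open>p(i)\<close> is \<open>p ! (i - 1)\<close>.
\<close>

definition perms :: "nat \<Rightarrow> nat list set" where
  "perms n = permutations_of_set {1..n}"

definition contains_pattern :: "nat list \<Rightarrow> nat list \<Rightarrow> bool" where
  "contains_pattern p q \<longleftrightarrow>
     (\<exists>i :: nat \<Rightarrow> nat.
        strict_mono_on {..<length q} i \<and>
        (\<forall>a < length q. i a < length p) \<and>
        (\<forall>a b. a < b \<and> b < length q \<longrightarrow> (p ! i a < p ! i b \<longleftrightarrow> q ! a < q ! b)))"

abbreviation avoids :: "nat list \<Rightarrow> nat list \<Rightarrow> bool" where
  "avoids p q \<equiv> \<not> contains_pattern p q"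

text \<open>
  The list \<open>rotate1 p\<close> is \<open>p(2) p(3) \<dots> p(n) p(1)\<close>, the one-line notation of \<open>p\<^sup>(\<^sup>2\<^sup>)\<close>.
\<close>

definition avoiders2 :: "nat \<Rightarrow> nat list \<Rightarrow> nat list \<Rightarrow> nat list set" where
  "avoiders2 n q1 q2 = {p \<in> perms n. avoids p q1 \<and> avoids (rotate1 p) q2}"

end

theory Submission
  imports Defs
begin

text \<open>
  Write \<open>p = k w\<close>. Then \<open>p\<close> is counted iff \<open>w\<close> avoids 123 and 231 and its entries above \<open>k\<close> are
  decreasing. A word avoiding 123 and 231 is either decreasing, or a decreasing word in which the
  block of entries in \<open>(j, M]\<close> has been moved behind the entries \<open>\<le> j\<close>, for unique entries \<open>j < M\<close>;
  in the latter case the condition on \<open>k\<close> reads \<open>j < k\<close>. The decreasing words contribute \<open>n\<close>, and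
  the others correspond to the triples \<open>(j, k, M)\<close> with \<open>j < k\<close>, \<open>j < M\<close> and \<open>k \<noteq> M\<close>: two for each
  3-subset.
\<close>

section \<open>Patterns of length 3 as recursive conditions on words\<close>

primrec triplewise :: "('a \<Rightarrow> 'a \<Rightarrow> 'a \<Rightarrow> bool) \<Rightarrow> 'a list \<Rightarrow> bool" where
  "triplewise Q [] \<longleftrightarrow> True"
| "triplewise Q (x # xs) \<longleftrightarrow> sorted_wrt (Q x) xs \<and> triplewise Q xs"

text \<open>Rotation moves the first entry \<open>k\<close> of \<open>k # w\<close> to the end.
  Together with the recursion equation for \<open>#\<close>, this splits off the triples that
  involve \<open>k\<close>, both in the word and in its rotation, as a condition on pairs in
  \<open>w\<close>.\<close>

lemma triplewise_snoc:
  "triplewise Q (xs @ [z]) \<longleftrightarrow> triplewise Q xs \<and> sorted_wrt (\<lambda>x y. Q x y z) xs"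
  by (induction xs) (auto simp: sorted_wrt_append)

lemma triplewise_iff_nth:
  "triplewise Q xs \<longleftrightarrow>
     (\<forall>i j k. i < j \<longrightarrow> j < k \<longrightarrow> k < length xs \<longrightarrow> Q (xs ! i) (xs ! j) (xs ! k))"
proof (induction xs)
  case Nil
  then show ?case by simp
next
  case (Cons x xs)
  let ?P = "\<lambda>i j k. Q ((x # xs) ! i) ((x # xs) ! j) ((x # xs) ! k)"
  \<comment> \<open>The last two indices are positive, hence successors; \<open>i\<close> stays
    arbitrary so that the next step can separate \<open>i = 0\<close> from
    \<open>i > 0\<close>.\<close>
  have "(\<forall>i j k. i < j \<longrightarrow> j < k \<longrightarrow> k < length (x # xs) \<longrightarrow> ?P i j k) \<longleftrightarrow>
        (\<forall>i j k. i < Suc j \<longrightarrow> j < k \<longrightarrow> k < length xs \<longrightarrow> ?P i (Suc j) (Suc k))" (is "?L \<longleftrightarrow> ?R")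
  proof
    assume L: ?L
    show ?R
    proof (intro allI impI)
      fix i j k assume "i < Suc j" "j < k" "k < length xs"
      then show "?P i (Suc j) (Suc k)" using L[rule_format, of i "Suc j" "Suc k"] by simp
    qed
  next
    assume R: ?R
    show ?L
    proof (intro allI impI)
      fix i j k assume *: "i < j" "j < k" "k < length (x # xs)"
      then obtain j' k' where "j = Suc j'" "k = Suc k'" by (metis less_imp_Suc_add)
      with * R show "?P i j k" by auto
    qed
  qed
  also have "\<dots> \<longleftrightarrow> (\<forall>j k. j < k \<longrightarrow> k < length xs \<longrightarrow> Q x (xs ! j) (xs ! k)) \<and>
      (\<forall>i j k. i < j \<longrightarrow> j < k \<longrightarrow> k < length xs \<longrightarrow> Q (xs ! i) (xs ! j) (xs ! k))"
    (is "?L \<longleftrightarrow> ?R1 \<and> ?R2")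
  proof
    assume L: ?L
    have ?R1 using L[rule_format, of 0] by auto
    moreover have ?R2 using L[rule_format, of "Suc _"] by auto
    ultimately show "?R1 \<and> ?R2" by blast
  next
    assume R: "?R1 \<and> ?R2"
    show ?L
    proof (intro allI impI)
      fix i j k assume *: "i < Suc j" "j < k" "k < length xs"
      then show "?P i (Suc j) (Suc k)" using R by (cases i) auto
    qed
  qed
  finally show ?case
    using Cons.IH by (simp add: sorted_wrt_iff_nth_less)
qed

lemma avoids_3_iff_triplewise:
  "avoids p [a, b, c] \<longleftrightarrow>
     triplewise (\<lambda>x y z. \<not> ((x < y \<longleftrightarrow> a < b) \<and> (x < z \<longleftrightarrow> a < c) \<and> (y < z \<longleftrightarrow> b < c))) p"
proof -
  let ?Q = "\<lambda>i j k. (p ! i < p ! j \<longleftrightarrow> a < b) \<and> (p ! i < p ! k \<longleftrightarrow> a < c) \<and> (p ! j < p ! k \<longleftrightarrow> b < c)"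
  have "contains_pattern p [a, b, c] \<longleftrightarrow> (\<exists>i j k. i < j \<and> j < k \<and> k < length p \<and> ?Q i j k)" (is "_ \<longleftrightarrow> ?R")
  proof
    assume "contains_pattern p [a, b, c]"
    then obtain f :: "nat \<Rightarrow> nat" where mono: "strict_mono_on {..<3} f" and len: "\<forall>l<3. f l < length p"
      and pat: "\<forall>l m. l < m \<and> m < 3 \<longrightarrow> (p ! f l < p ! f m \<longleftrightarrow> [a, b, c] ! l < [a, b, c] ! m)"
      by (auto simp: contains_pattern_def numeral_3_eq_3)
    have "f 0 < f 1" "f 1 < f 2" using mono by (auto simp: strict_mono_on_def)
    moreover have "f 2 < length p" using len by simp
    moreover have "?Q (f 0) (f 1) (f 2)"
      using pat[rule_format, of 0 1] pat[rule_format, of 0 2] pat[rule_format, of 1 2] by simp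
    ultimately show ?R by blast
  next
    assume ?R
    then obtain i j k where "i < j" "j < k" "k < length p" "?Q i j k" by blast
    then show "contains_pattern p [a, b, c]"
      unfolding contains_pattern_def
      \<comment> \<open>List lookup serves as the index function, since only its values at 0, 1, 2
        matter.\<close>
      by (intro exI[of _ "\<lambda>l. [i, j, k] ! l"])
         (auto simp: strict_mono_on_def less_Suc_eq numeral_2_eq_2)
  qed
  then show ?thesis
    by (auto simp: triplewise_iff_nth)
qed

text \<open>Both patterns start with an ascent from their first letter, here \<open>x < y\<close>.
  For distinct entries, 123 then excludes \<open>y < z\<close> and 231 excludes
  \<open>z < x\<close>, which leaves only \<open>z\<close> strictly between \<open>x\<close> and
  \<open>y\<close>.\<close>

primrec avoids_123_231 :: "nat list \<Rightarrow> bool" where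
  "avoids_123_231 [] \<longleftrightarrow> True"
| "avoids_123_231 (x # w) \<longleftrightarrow>
     sorted_wrt (\<lambda>y z. x < y \<longrightarrow> x < z \<and> z < y) w \<and> avoids_123_231 w"

lemma sorted_wrt_conj:
  "sorted_wrt (\<lambda>x y. P x y \<and> Q x y) xs \<longleftrightarrow> sorted_wrt P xs \<and> sorted_wrt Q xs"
  by (induction xs) auto

text \<open>Pattern conditions contain negations of \<open><\<close>; between distinct entries these
  become reversed strict comparisons.\<close>

lemma sorted_wrt_cong_distinct:
  assumes "distinct xs" "\<And>x y. x \<in> set xs \<Longrightarrow> y \<in> set xs \<Longrightarrow> x \<noteq> y \<Longrightarrow> P x y \<longleftrightarrow> Q x y"
  shows "sorted_wrt P xs \<longleftrightarrow> sorted_wrt Q xs"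
  using assms
proof (induction xs)
  case (Cons a xs)
  then have "P a y \<longleftrightarrow> Q a y" if "y \<in> set xs" for y using that by auto
  moreover have "sorted_wrt P xs \<longleftrightarrow> sorted_wrt Q xs" using Cons by simp
  ultimately show ?case by simp
qed simp

lemma triplewise_123_231:
  assumes "distinct w"
  shows "triplewise (\<lambda>x y z. \<not> (x < y \<and> x < z \<and> y < z)) w \<and>
         triplewise (\<lambda>x y z. \<not> (x < y \<and> \<not> x < z \<and> \<not> y < z)) w \<longleftrightarrow> avoids_123_231 w"
  using assms
proof (induction w)
  case Nil
  then show ?case by simp
next
  case (Cons x w)
  have "sorted_wrt (\<lambda>y z. \<not> (x < y \<and> x < z \<and> y < z) \<and> \<not> (x < y \<and> \<not> x < z \<and> \<not> y < z)) w \<longleftrightarrow>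
        sorted_wrt (\<lambda>y z. x < y \<longrightarrow> x < z \<and> z < y) w"
    using Cons.prems by (intro sorted_wrt_cong_distinct) auto
  then show ?case using Cons by (auto simp: sorted_wrt_conj)
qed

text \<open>Moved to the end, the first entry \<open>k\<close> can only play the role of 1 in 231; this imposes the
  same condition as its role of 1 in 123 does when it stands at the front.\<close>

lemma avoids_Cons_iff:
  assumes "distinct (k # w)"
  shows "avoids (k # w) [1, 2, 3] \<and> avoids (rotate1 (k # w)) [2, 3, 1] \<longleftrightarrow>
         avoids_123_231 w \<and> sorted_wrt (\<lambda>y z. k < y \<longrightarrow> z < y) w"
proof -
  have "sorted_wrt (\<lambda>y z. \<not> (k < y \<and> k < z \<and> y < z) \<and> \<not> (y < z \<and> \<not> y < k \<and> \<not> z < k)) w \<longleftrightarrow>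
        sorted_wrt (\<lambda>y z. k < y \<longrightarrow> z < y) w"
    using assms by (intro sorted_wrt_cong_distinct) (auto, metis linorder_neqE_nat)
  then show ?thesis
    using triplewise_123_231[of w] assms
    by (auto simp: avoids_3_iff_triplewise triplewise_snoc sorted_wrt_conj)
qed

section \<open>Decreasing words and block words\<close>

abbreviation desc :: "nat set \<Rightarrow> nat list" where
  "desc X \<equiv> rev (sorted_list_of_set X)"

lemma sorted_wrt_desc: "sorted_wrt (>) (desc X)"
  by (simp add: sorted_wrt_rev)

lemma desc_unique:
  assumes "sorted_wrt (>) xs"
  shows "xs = desc (set xs)"
proof -
  have "sorted_wrt (<) (rev xs)" using assms by (simp add: sorted_wrt_rev)
  then have "sorted_list_of_set (set (rev xs)) = rev xs"
    by (intro sorted_list_of_set.idem_if_sorted_distinct) (auto simp: strict_sorted_iff)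
  then show ?thesis by simp
qed

lemma last_desc:
  assumes "finite X" "X \<noteq> {}"
  shows "last (desc X) = Min X"
  using assms by (simp add: last_rev sorted_list_of_set_nonempty)

lemma desc_insert_greater:
  assumes "finite X" "\<And>y. y \<in> X \<Longrightarrow> y < x"
  shows "desc (insert x X) = x # desc X"
  using desc_unique[of "x # desc X"] assms by (simp add: sorted_wrt_desc)

text \<open>For \<open>j < M\<close> both in \<open>S\<close>, the second block starts with
  \<open>j\<close> and the third with \<open>M\<close>, so the word has exactly one ascent between
  neighbours, where these two blocks meet.\<close>

definition block_desc :: "nat set \<Rightarrow> nat \<Rightarrow> nat \<Rightarrow> nat list" where
  "block_desc S j M = desc {x\<in>S. M < x} @ desc {x\<in>S. x \<le> j} @ desc {x\<in>S. j < x \<and> x \<le> M}"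

lemma set_block_desc:
  assumes "finite S" "j < M"
  shows "set (block_desc S j M) = S"
  using assms by (auto simp: block_desc_def)

lemma distinct_block_desc:
  assumes "finite S" "j < M"
  shows "distinct (block_desc S j M)"
  using assms by (auto simp: block_desc_def)

section \<open>Classification of the words avoiding 123 and 231\<close>

lemma avoids_123_231_append_greater:
  assumes "sorted_wrt (>) u" "\<And>x y. x \<in> set u \<Longrightarrow> y \<in> set v \<Longrightarrow> y < x" "avoids_123_231 v"
  shows "avoids_123_231 (u @ v)"
  using assms(1,2)
proof (induction u)
  case Nil
  then show ?case using assms(3) by simp
next
  case (Cons x u)
  \<comment> \<open>Nothing after \<open>x\<close> exceeds it, so the condition for \<open>x\<close>
    is vacuous.\<close>
  have "y < x" if "y \<in> set (u @ v)" for y using Cons.prems that by auto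
  then have "sorted_wrt (\<lambda>y z. x < y \<longrightarrow> x < z \<and> z < y) (u @ v)"
    unfolding sorted_wrt_iff_nth_less
    by (metis dual_order.strict_trans less_irrefl nth_mem)
  then show ?case using Cons by simp
qed

text \<open>An entry \<open>x\<close> of \<open>u\<close> is exceeded only by entries of
  \<open>v\<close>. Since \<open>v\<close> decreases and lies above \<open>x\<close>, whatever
  follows such a larger entry is again between it and \<open>x\<close>.\<close>

lemma avoids_123_231_append_less:
  assumes "sorted_wrt (>) u" "\<And>x y. x \<in> set u \<Longrightarrow> y \<in> set v \<Longrightarrow> x < y" "sorted_wrt (>) v"
  shows "avoids_123_231 (u @ v)"
  using assms(1,2)
proof (induction u)
  case Nil
  then show ?case using avoids_123_231_append_greater[of v "[]"] assms(3) by simp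
next
  case (Cons x u)
  have below: "y < x" if "y \<in> set u" for y using Cons.prems(1) that by simp
  have above: "x < y" if "y \<in> set v" for y using Cons.prems(2)[of x y] that by simp
  have "sorted_wrt (\<lambda>y z. x < y \<longrightarrow> x < z \<and> z < y) (u @ v)"
    unfolding sorted_wrt_append
  proof (intro conjI ballI)
    show "sorted_wrt (\<lambda>y z. x < y \<longrightarrow> x < z \<and> z < y) u"
      by (rule sorted_wrt_mono_rel[of u "(>)"]) (use Cons.prems(1) in \<open>auto dest: below\<close>)
    show "sorted_wrt (\<lambda>y z. x < y \<longrightarrow> x < z \<and> z < y) v"
      by (rule sorted_wrt_mono_rel[OF _ assms(3)]) (simp add: above)
    show "x < y \<longrightarrow> x < z \<and> z < y" if "y \<in> set u" for y z
      using below[OF that] by simp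
  qed
  moreover have "avoids_123_231 (u @ v)"
    by (rule Cons.IH) (use Cons.prems in auto)
  ultimately show ?case by simp
qed

lemma avoids_123_231_desc: "avoids_123_231 (desc X)"
  using avoids_123_231_append_greater[OF sorted_wrt_desc, of X "[]"] by simp

lemma avoids_123_231_block_desc:
  assumes "finite S" "j < M"
  shows "avoids_123_231 (block_desc S j M)"
  unfolding block_desc_def using assms
  by (intro avoids_123_231_append_greater avoids_123_231_append_less sorted_wrt_desc) auto

lemma append_filter_eq:
  assumes "sorted_wrt (\<lambda>y z. \<not> P y \<longrightarrow> \<not> P z) xs"
  shows "xs = filter P xs @ filter (\<lambda>x. \<not> P x) xs"
  using assms
proof (induction xs)
  case (Cons x xs)
  then show ?case by (cases "P x") (auto simp: filter_empty_conv)
qed simp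

text \<open>Induction on the word. A first entry above all others is added in front of the form of
  the tail. Any other first entry \<open>x\<close> is itself the parameter \<open>j\<close>, and
  \<open>M\<close> is the maximum: the tail consists of entries below \<open>x\<close> followed by
  entries above \<open>x\<close>, both decreasing.\<close>

lemma avoids_123_231_cases:
  assumes "avoids_123_231 w" "distinct w" "w \<noteq> desc (set w)"
  shows "\<exists>j M. j \<in> set w \<and> M \<in> set w \<and> j < M \<and> w = block_desc (set w) j M"
  using assms
proof (induction w)
  case Nil
  then show ?case by simp
next
  case (Cons x w)
  show ?case
  proof (cases "\<forall>y\<in>set w. y < x")
    case True
    then have "desc (insert x (set w)) = x # desc (set w)"
      by (intro desc_insert_greater) auto
    then have "w \<noteq> desc (set w)" using Cons.prems by auto
    then obtain j M where jM: "j \<in> set w" "M \<in> set w" "j < M" "w = block_desc (set w) j M"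
      using Cons by auto
    \<comment> \<open>Since \<open>x\<close> exceeds both \<open>j\<close> and \<open>M\<close>, it
      joins only the first block.\<close>
    have sets: "{y \<in> set (x # w). M < y} = insert x {y \<in> set w. M < y}"
      "{y \<in> set (x # w). y \<le> j} = {y \<in> set w. y \<le> j}"
      "{y \<in> set (x # w). j < y \<and> y \<le> M} = {y \<in> set w. j < y \<and> y \<le> M}"
      using True jM by fastforce+
    have "desc (insert x {y \<in> set w. M < y}) = x # desc {y \<in> set w. M < y}"
      using True by (intro desc_insert_greater) auto
    then have "block_desc (set (x # w)) j M = x # block_desc (set w) j M"
      unfolding block_desc_def sets by simp
    then have "x # w = block_desc (set (x # w)) j M" using jM(4) by simp
    then show ?thesis using jM by (metis list.set_intros(2))
  next
    case False
    define M where "M = Max (set w)"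
    have wne: "w \<noteq> []" using False by auto
    then have M: "M \<in> set w" "\<And>y. y \<in> set w \<Longrightarrow> y \<le> M" by (auto simp: M_def)
    have xM: "x < M" using False M Cons.prems(2)
      by (metis distinct.simps(2) linorder_neqE_nat le_less_trans)
    have srt: "sorted_wrt (\<lambda>y z. x < y \<longrightarrow> x < z \<and> z < y) w" using Cons.prems(1) by simp
    \<comment> \<open>Once an entry above \<open>x\<close> has occurred, all later entries are above
      \<open>x\<close> too.\<close>
    have split: "w = filter (\<lambda>y. y < x) w @ filter (\<lambda>y. \<not> y < x) w"
      using Cons.prems(2)
      by (intro append_filter_eq sorted_wrt_mono_rel[OF _ srt]) (metis distinct.simps(2) less_asym linorder_neqE_nat)
    define A where "A = filter (\<lambda>y. y < x) w"
    define B where "B = filter (\<lambda>y. \<not> y < x) w"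
    have w: "w = A @ B" using split by (simp add: A_def B_def)
    have setA: "set A = {y \<in> set w. y < x}" by (auto simp: A_def)
    have setB: "set B = {y \<in> set w. x < y}" using Cons.prems(2) nat_neq_iff by (auto simp: B_def)
    have "sorted_wrt (\<lambda>y z. x < y \<longrightarrow> x < z \<and> z < y) B" using srt w by (simp add: sorted_wrt_append)
    then have B: "sorted_wrt (>) B"
      by (rule sorted_wrt_mono_rel[rotated]) (auto simp: setB)
    have MB: "M \<in> set B" using M xM setB by auto
    have "avoids_123_231 (A @ B)" "distinct (A @ B)" using Cons.prems w by simp_all
    moreover have "\<And>y. y \<in> set A \<Longrightarrow> y < M" using xM setA by auto
    \<comment> \<open>An ascent \<open>a < z\<close> within \<open>A\<close> would form 123 with the
      later, larger entry \<open>M\<close> of \<open>B\<close>.\<close>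
    ultimately have A: "sorted_wrt (>) A"
      using MB
    proof (induction A)
      case (Cons a A)
      have "z < a" if "z \<in> set A" for z
      proof (rule ccontr)
        assume "\<not> z < a"
        moreover have "z \<noteq> a" using that Cons.prems(2) by auto
        ultimately have "a < z" by simp
        moreover have "a < z \<longrightarrow> a < M \<and> M < z"
          using Cons.prems(1,4) that
          unfolding append_Cons avoids_123_231.simps sorted_wrt_append by blast
        moreover have "z < M" using Cons.prems(3)[of z] that by simp
        ultimately show False by simp
      qed
      moreover have "sorted_wrt (>) A"
      proof (rule Cons.IH)
        show "avoids_123_231 (A @ B)" using Cons.prems(1) unfolding append_Cons avoids_123_231.simps by blast
      qed (use Cons.prems(2-) in auto)
      ultimately show ?case by simp
    qed simp
    have "x # A = desc {y \<in> set (x # w). y \<le> x}"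
    proof -
      have "{y \<in> set (x # w). y \<le> x} = set (x # A)" by (auto simp: setA)
      then show ?thesis using desc_unique[of "x # A"] A setA by auto
    qed
    moreover have "B = desc {y \<in> set (x # w). x < y \<and> y \<le> M}"
    proof -
      have "{y \<in> set (x # w). x < y \<and> y \<le> M} = set B" using M(2) by (auto simp: setB)
      then show ?thesis using desc_unique[OF B] by simp
    qed
    \<comment> \<open>As \<open>M\<close> is the maximum, the first block is empty.\<close>
    moreover have "{y \<in> set (x # w). M < y} = {}" using M(2) xM by (auto simp: not_less)
    ultimately have "x # w = block_desc (set (x # w)) x M"
      unfolding block_desc_def w by simp
    then show ?thesis using xM M(1) by (metis list.set_intros)
  qed
qed

section \<open>Uniqueness of the parameters and the condition on the first entry\<close>

lemma last_block_desc:
  assumes "finite S" "M \<in> S" "j < M"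
  shows "last (block_desc S j M) = Min {x\<in>S. j < x}"
proof -
  let ?C = "{x\<in>S. j < x \<and> x \<le> M}"
  have C: "finite ?C" "?C \<noteq> {}" using assms by auto
  then have "desc ?C \<noteq> []" by simp
  then have "last (block_desc S j M) = Min ?C"
    using last_desc[OF C] by (simp add: block_desc_def)
  also have "Min ?C = Min {x\<in>S. j < x}"
  proof (rule sym, rule Min_eqI)
    show "Min ?C \<in> {x\<in>S. j < x}" using Min_in[OF C] by auto
    have "Min ?C \<le> M" using assms by (intro Min_le) auto
    show "Min ?C \<le> y" if "y \<in> {x\<in>S. j < x}" for y
      using that Min_le[OF C(1), of y] \<open>Min ?C \<le> M\<close> by (cases "y \<le> M") auto
  qed (use assms in auto)
  finally show ?thesis .
qed

text \<open>The last entries differ: that of \<open>desc S\<close> is at most \<open>j\<close>, that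
  of the block word is greater than \<open>j\<close>.\<close>

lemma desc_neq_block_desc:
  assumes "finite S" "j \<in> S" "M \<in> S" "j < M"
  shows "desc S \<noteq> block_desc S j M"
proof
  assume eq: "desc S = block_desc S j M"
  have "Min {x\<in>S. j < x} \<in> {x\<in>S. j < x}" using assms by (intro Min_in) auto
  moreover have "Min S \<le> j" using assms by simp
  moreover have "Min S = Min {x\<in>S. j < x}"
    using assms last_desc[of S] last_block_desc[of S M j] unfolding eq by fastforce
  ultimately show False by auto
qed

text \<open>The last entry is the successor of \<open>j\<close> in \<open>S\<close> and so
  determines \<open>j\<close>. The entries standing before the first one that is at most
  \<open>j\<close> are those above \<open>M\<close>, and they determine \<open>M\<close>.\<close>

lemma block_desc_inject:
  assumes "finite S" "j \<in> S" "M \<in> S" "j < M" "j' \<in> S" "M' \<in> S" "j' < M'"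
    and eq: "block_desc S j M = block_desc S j' M'"
  shows "j = j' \<and> M = M'"
proof -
  \<comment> \<open>If \<open>a < b\<close>, the successor of \<open>a\<close> in \<open>S\<close>
    is at most \<open>b\<close>, hence below the successor of \<open>b\<close>. The element
    \<open>B\<close> guarantees that the latter exists.\<close>
  have le: "b \<le> a" if "Min {x\<in>S. a < x} = Min {x\<in>S. b < x}" "b \<in> S" "B \<in> S" "b < B" for a b B
  proof (rule ccontr)
    assume "\<not> b \<le> a"
    then have "Min {x\<in>S. a < x} \<le> b" using that assms(1) by (intro Min_le) auto
    moreover have "Min {x\<in>S. b < x} \<in> {x\<in>S. b < x}" using that assms(1) by (intro Min_in) auto
    ultimately show False using that(1) by auto
  qed
  have "Min {x\<in>S. j < x} = Min {x\<in>S. j' < x}"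
    using last_block_desc[of S M j] last_block_desc[of S M' j'] assms by simp
  then have j: "j = j'" using le[of j j' M'] le[of j' j M] assms by auto
  \<comment> \<open>The run of entries above \<open>j\<close> stops at the second block, which is
    nonempty because it contains \<open>j\<close>.\<close>
  have top: "set (takeWhile (\<lambda>x. j < x) (block_desc S j N)) = {x\<in>S. N < x}" if "j < N" for N
  proof -
    have "takeWhile (\<lambda>x. j < x) (block_desc S j N) =
        desc {x\<in>S. N < x} @ takeWhile (\<lambda>x. j < x) (desc {x\<in>S. x \<le> j} @ desc {x\<in>S. j < x \<and> x \<le> N})"
      unfolding block_desc_def using that assms(1) by (intro takeWhile_append2) auto
    also have "takeWhile (\<lambda>x. j < x) (desc {x\<in>S. x \<le> j} @ desc {x\<in>S. j < x \<and> x \<le> N}) = []"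
    proof -
      have "desc {x\<in>S. x \<le> j} \<noteq> []" using assms(1,2) by auto
      then obtain y ys where y: "desc {x\<in>S. x \<le> j} = y # ys" by (meson neq_Nil_conv)
      then have "y \<in> set (desc {x\<in>S. x \<le> j})" by simp
      then have "y \<le> j" using assms(1) by simp
      then show ?thesis by (simp add: y)
    qed
    finally show ?thesis using assms(1) by simp
  qed
  have "{x\<in>S. M < x} = {x\<in>S. M' < x}"
    using top[of M] top[of M'] eq j assms(4,7) by simp
  then have "M = M'" using assms(3,6) by (metis (mono_tags, lifting) linorder_neqE_nat mem_Collect_eq less_irrefl)
  with j show ?thesis by simp
qed

text \<open>A larger entry follows an earlier one only from the second block to the third, so the
  smaller one is at most \<open>j\<close>. If \<open>j < k\<close>, it does not exceed
  \<open>k\<close> and no restriction arises; if \<open>k < j\<close>, the pair \<open>j\<close>,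
  \<open>M\<close> violates the condition.\<close>

lemma sorted_wrt_above_block_desc_iff:
  assumes "finite S" "j \<in> S" "M \<in> S" "j < M" "k \<notin> S"
  shows "sorted_wrt (\<lambda>y z. k < y \<longrightarrow> z < y) (block_desc S j M) \<longleftrightarrow> j < k"
proof
  assume "sorted_wrt (\<lambda>y z. k < y \<longrightarrow> z < y) (block_desc S j M)"
  then have "k < j \<longrightarrow> M < j"
    using assms(1-4) by (auto simp: block_desc_def sorted_wrt_append)
  moreover have "j \<noteq> k" using assms by auto
  ultimately show "j < k" using assms(4) by auto
next
  assume "j < k"
  moreover have "sorted_wrt (\<lambda>y z. k < y \<longrightarrow> z < y) (desc X)" for X
    by (rule sorted_wrt_mono_rel[OF _ sorted_wrt_desc]) simp
  ultimately show "sorted_wrt (\<lambda>y z. k < y \<longrightarrow> z < y) (block_desc S j M)"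
    using assms(1,4) by (auto simp: block_desc_def sorted_wrt_append)
qed

section \<open>Counting by first entry\<close>

definition tails :: "nat set \<Rightarrow> nat \<Rightarrow> nat list set" where
  "tails S k = {w \<in> permutations_of_set S. avoids_123_231 w \<and> sorted_wrt (\<lambda>y z. k < y \<longrightarrow> z < y) w}"

definition block_params :: "nat set \<Rightarrow> nat \<Rightarrow> (nat \<times> nat) set" where
  "block_params S k = {(j, M) \<in> S \<times> S. j < k \<and> j < M}"

lemma tails_eq:
  assumes "finite S" "k \<notin> S"
  shows "tails S k = insert (desc S) ((\<lambda>(j, M). block_desc S j M) ` block_params S k)"
proof (intro equalityI subsetI)
  fix w assume w: "w \<in> tails S k"
  then have *: "distinct w" "set w = S" "avoids_123_231 w" "sorted_wrt (\<lambda>y z. k < y \<longrightarrow> z < y) w"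
    by (auto simp: tails_def permutations_of_set_def)
  show "w \<in> insert (desc S) ((\<lambda>(j, M). block_desc S j M) ` block_params S k)"
  proof (cases "w = desc S")
    case False
    then obtain j M where jM: "j \<in> S" "M \<in> S" "j < M" "w = block_desc S j M"
      using avoids_123_231_cases[of w] * by auto
    then have "j < k"
      using sorted_wrt_above_block_desc_iff[OF assms(1) jM(1-3) assms(2)] *(4) by simp
    with jM show ?thesis by (auto simp: block_params_def)
  qed simp
next
  fix w assume "w \<in> insert (desc S) ((\<lambda>(j, M). block_desc S j M) ` block_params S k)"
  \<comment> \<open>A decreasing word meets the condition for every \<open>k\<close>.\<close>
  moreover have "desc S \<in> tails S k"
    using assms(1) sorted_wrt_mono_rel[OF _ sorted_wrt_desc, of S "\<lambda>y z. k < y \<longrightarrow> z < y"]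
    by (simp add: tails_def permutations_of_set_def avoids_123_231_desc)
  ultimately show "w \<in> tails S k"
    using assms sorted_wrt_above_block_desc_iff[OF assms(1) _ _ _ assms(2)]
    by (auto simp: tails_def block_params_def permutations_of_set_def set_block_desc
        distinct_block_desc avoids_123_231_block_desc)
qed

lemma finite_block_params: "finite S \<Longrightarrow> finite (block_params S k)"
  by (rule finite_subset[of _ "S \<times> S"]) (auto simp: block_params_def)

lemma card_tails:
  assumes "finite S" "k \<notin> S"
  shows "card (tails S k) = Suc (card (block_params S k))"
proof -
  have "inj_on (\<lambda>(j, M). block_desc S j M) (block_params S k)"
    using block_desc_inject[OF assms(1)] by (auto simp: inj_on_def block_params_def)
  moreover have "desc S \<notin> (\<lambda>(j, M). block_desc S j M) ` block_params S k"
    using desc_neq_block_desc[OF assms(1)] by (auto simp: block_params_def)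
  ultimately show ?thesis
    using assms finite_block_params by (simp add: tails_eq card_image)
qed

lemma avoiders2_eq_UN_tails:
  assumes "n > 0"
  shows "avoiders2 n [1, 2, 3] [2, 3, 1] = (\<Union>k\<in>{1..n}. (#) k ` tails ({1..n} - {k}) k)"
proof (intro equalityI subsetI)
  fix p assume p: "p \<in> avoiders2 n [1, 2, 3] [2, 3, 1]"
  then have "p \<noteq> []" using assms by (auto simp: avoiders2_def perms_def permutations_of_set_def)
  then obtain k w where "p = k # w" by (meson neq_Nil_conv)
  moreover from this p have "distinct (k # w)" "set (k # w) = {1..n}"
    by (auto simp: avoiders2_def perms_def permutations_of_set_def)
  moreover from this have "set w = {1..n} - {k}" "k \<in> {1..n}" by auto
  ultimately show "p \<in> (\<Union>k\<in>{1..n}. (#) k ` tails ({1..n} - {k}) k)"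
    using p avoids_Cons_iff[of k w]
    by (auto simp: avoiders2_def tails_def permutations_of_set_def)
next
  fix p assume "p \<in> (\<Union>k\<in>{1..n}. (#) k ` tails ({1..n} - {k}) k)"
  then obtain k w where p: "p = k # w" "k \<in> {1..n}" "w \<in> tails ({1..n} - {k}) k" by auto
  from p(3) have w: "distinct w" "set w = {1..n} - {k}"
    and good: "avoids_123_231 w" "sorted_wrt (\<lambda>y z. k < y \<longrightarrow> z < y) w"
    unfolding tails_def permutations_of_set_def by blast+
  have kw: "distinct (k # w)" "set (k # w) = {1..n}" using w p(2) by (simp_all add: insert_absorb)
  then have "k # w \<in> perms n" by (simp add: perms_def permutations_of_set_def)
  with avoids_Cons_iff[OF kw(1)] good show "p \<in> avoiders2 n [1, 2, 3] [2, 3, 1]"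
    unfolding p(1) avoiders2_def by blast
qed

lemma card_pairs_distinct:
  assumes "finite A"
  shows "card {(x, y) \<in> A \<times> A. x \<noteq> y} = 2 * (card A choose 2)"
proof -
  have "{(x, y) \<in> A \<times> A. x \<noteq> y} = (SIGMA x:A. A - {x})" by auto
  then have "card {(x, y) \<in> A \<times> A. x \<noteq> y} = (\<Sum>x\<in>A. card (A - {x}))"
    using assms by simp
  also have "\<dots> = card A * (card A - 1)" using assms by simp
  also have "\<dots> = 2 * (card A choose 2)" by (cases "card A") (simp_all add: choose_two)
  finally show ?thesis .
qed

text \<open>Double counting of the triples \<open>(k, j, M)\<close>: grouped by their least member
  \<open>j\<close>, they become ordered pairs of distinct elements of \<open>{j<..n}\<close>. Here
  \<open>k\<close> and \<open>M\<close> differ because \<open>k\<close> is removed from the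
  available entries.\<close>

lemma sum_card_block_params:
  "(\<Sum>k\<in>{1..n}. card (block_params ({1..n} - {k}) k)) = 2 * (n choose 3)"
proof -
  let ?K = "SIGMA k:{1..n}. block_params ({1..n} - {k}) k"
  let ?J = "SIGMA j:{1..n}. {(k, M) \<in> {j<..n} \<times> {j<..n}. k \<noteq> M}"
  have fin: "finite {(k, M) \<in> {j<..n} \<times> {j<..n}. k \<noteq> M}" for j
    by (rule finite_subset[of _ "{j<..n} \<times> {j<..n}"]) auto
  have "(\<Sum>k\<in>{1..n}. card (block_params ({1..n} - {k}) k)) = card ?K"
    by (simp add: finite_block_params)
  also have "card ?K = card ?J"
    by (rule bij_betw_same_card[of "\<lambda>(k, j, M). (j, k, M)"],
        rule bij_betw_byWitness[where f' = "\<lambda>(j, k, M). (k, j, M)"])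
       (auto simp: block_params_def)
  also have "\<dots> = (\<Sum>j\<in>{1..n}. 2 * ((n - j) choose 2))"
    unfolding card_SigmaI[OF finite_atLeastAtMost ballI[OF fin]] card_pairs_distinct[OF finite_greaterThanAtMost]
    by simp
  also have "\<dots> = 2 * (\<Sum>j\<in>{1..n}. (n - j) choose 2)"
    by (simp add: sum_distrib_left)
  also have "(\<Sum>j\<in>{1..n}. (n - j) choose 2) = (\<Sum>i<n. i choose 2)"
    by (rule sum.reindex_bij_witness[of _ "\<lambda>i. n - i" "\<lambda>j. n - j"]) auto
  \<comment> \<open>The hockey-stick identity; each induction step is Pascal's rule.\<close>
  also have "\<dots> = n choose 3"
    by (induction n) (auto simp: numeral_3_eq_3 numeral_2_eq_2)
  finally show ?thesis .
qed

theorem proposition5p8: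
  fixes n :: nat
  assumes "n \<ge> 2"
  shows "card (avoiders2 n [1, 2, 3] [2, 3, 1]) = n + 2 * (n choose 3)"
proof -
  let ?T = "\<lambda>k. tails ({1..n} - {k}) k"
  have fin: "finite (?T k)" for k
    by (rule finite_subset[of _ "permutations_of_set ({1..n} - {k})"]) (auto simp: tails_def)
  have "card (avoiders2 n [1, 2, 3] [2, 3, 1]) = (\<Sum>k\<in>{1..n}. card ((#) k ` ?T k))"
    \<comment> \<open>The sets in the union are disjoint because their words start with different
      entries.\<close>
    using assms fin by (simp only: avoiders2_eq_UN_tails) (subst card_UN_disjoint; auto)
  also have "\<dots> = (\<Sum>k\<in>{1..n}. Suc (card (block_params ({1..n} - {k}) k)))"
    by (simp add: card_image card_tails)
  also have "\<dots> = n + (\<Sum>k\<in>{1..n}. card (block_params ({1..n} - {k}) k))"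
    by (simp add: sum_Suc)
  finally show ?thesis by (simp only: sum_card_block_params)
qed

end
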